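(* For every integer $n\ge 2$, \[p_b(P_n)=\begin{cases} \frac{n}{4} & \text{if } n\equiv 0\pmod 8,\\ 2\left\lfloor\frac{n}{8}\right\rfloor+1 & \text{if } n\equiv 1,2,3\pmod 8,\\ 2\left\lfloor\frac{n}{8}\right\rfloor+2 & \text{if } n\equiv 4,5,6,7\pmod 8,\end{cases}\] where $P_n$ is the path of order $n$.
   Context: For a graph $G=(V,E)$, a broadcast is a function $f:V\to\{0,\dots,\operatorname{diam}(G)\}$ with $f(v)\le e_G(v)$ (eccentricity) for all $v$. Let $V^+_f=\{v: f(v)>0\}$ and $H_f(u)=\{v\in V^+_f: d_G(u,v)\le f(v)\}$. The cost is $\sigma(f)=\sum_v f(v)$. $f$ is a packing broadcast if $|H_f(u)|\le1$ for every $u\in V$; it is maximal if no packing broadcast $g\ne f$ satisfies $g\ge f$ pointwise. $p_b(G)$ is the minimum cost of a maximal packing broadcast on $G$. *)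

theory Defs
  imports "Graph_Theory.Pair_Digraph" "HOL-Library.FuncSet"
begin

text \<open>
  Finite simple graphs are represented, as in the \<^locale>\<open>pair_graph\<close> locale, by finite, symmetric,
  loop-free pair digraphs: each edge \<open>uv\<close> appears as the two arcs \<open>(u, v)\<close> and \<open>(v, u)\<close>.

  The distance is a natural number, so it is meaningful only for vertices joined by a walk; it is
  intended for connected graphs, where the eccentricity and the diameter are finite.
\<close>

definition gdist :: "'a pair_pre_digraph \<Rightarrow> 'a \<Rightarrow> 'a \<Rightarrow> nat" where
  "gdist G u v = (LEAST k. \<exists>p. pre_digraph.awalk (with_proj G) u p v \<and> length p = k)"

definition eccentricity :: "'a pair_pre_digraph \<Rightarrow> 'a \<Rightarrow> nat" where
  "eccentricity G v = Max (gdist G v ` pverts G)"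

definition diam :: "'a pair_pre_digraph \<Rightarrow> nat" where
  "diam G = Max {gdist G u v | u v. u \<in> pverts G \<and> v \<in> pverts G}"

text \<open>
  Functions on the vertex set are extensional, so that two broadcasts are equal iff they agree on
  every vertex.
\<close>

definition broadcast :: "'a pair_pre_digraph \<Rightarrow> ('a \<Rightarrow> nat) \<Rightarrow> bool" where
  "broadcast G f \<longleftrightarrow>
     f \<in> pverts G \<rightarrow>\<^sub>E {0..diam G} \<and> (\<forall>v\<in>pverts G. f v \<le> eccentricity G v)"

definition broadcast_support :: "'a pair_pre_digraph \<Rightarrow> ('a \<Rightarrow> nat) \<Rightarrow> 'a set" where
  "broadcast_support G f = {v \<in> pverts G. f v > 0}"

definition hearing_set :: "'a pair_pre_digraph \<Rightarrow> ('a \<Rightarrow> nat) \<Rightarrow> 'a \<Rightarrow> 'a set" where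
  "hearing_set G f u = {v \<in> broadcast_support G f. gdist G u v \<le> f v}"

definition broadcast_cost :: "'a pair_pre_digraph \<Rightarrow> ('a \<Rightarrow> nat) \<Rightarrow> nat" where
  "broadcast_cost G f = (\<Sum>v\<in>pverts G. f v)"

definition packing_broadcast :: "'a pair_pre_digraph \<Rightarrow> ('a \<Rightarrow> nat) \<Rightarrow> bool" where
  "packing_broadcast G f \<longleftrightarrow>
     broadcast G f \<and> (\<forall>u\<in>pverts G. card (hearing_set G f u) \<le> 1)"

definition maximal_packing_broadcast :: "'a pair_pre_digraph \<Rightarrow> ('a \<Rightarrow> nat) \<Rightarrow> bool" where
  "maximal_packing_broadcast G f \<longleftrightarrow>
     packing_broadcast G f \<and>
     \<not> (\<exists>g. packing_broadcast G g \<and> g \<noteq> f \<and> (\<forall>v\<in>pverts G. f v \<le> g v))"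

definition lower_broadcast_packing_number :: "'a pair_pre_digraph \<Rightarrow> nat" ("p\<^sub>b") where
  "p\<^sub>b G = Min (broadcast_cost G ` {f. maximal_packing_broadcast G f})"

definition path_graph :: "nat \<Rightarrow> nat pair_pre_digraph" where
  "path_graph n =
     \<lparr> pverts = {1..n},
       parcs = {(i, j). i \<in> {1..n} \<and> j \<in> {1..n} \<and> (j = i + 1 \<or> i = j + 1)} \<rparr>"

lemma pair_graph_path_graph: "pair_graph (path_graph n)"
proof -
  have "finite (parcs (path_graph n))"
    by (rule finite_subset[of _ "{1..n} \<times> {1..n}"]) (auto simp: path_graph_def)
  moreover have "symmetric (path_graph n)"
    by (auto simp: symmetric_def sym_def path_graph_def)
  ultimately show ?thesis
    by unfold_locales (auto simp: path_graph_def)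
qed

text \<open>The minimum defining \<open>p\<^sub>b\<close> is attained on every finite graph.\<close>

lemma finite_maximal_packing_broadcasts:
  assumes "finite (pverts G)"
  shows "finite {f. maximal_packing_broadcast G f}"
proof (rule finite_subset)
  show "{f. maximal_packing_broadcast G f} \<subseteq> pverts G \<rightarrow>\<^sub>E {0..diam G}"
    by (auto simp: maximal_packing_broadcast_def packing_broadcast_def broadcast_def)
  show "finite (pverts G \<rightarrow>\<^sub>E {0..diam G})"
    using assms by (intro finite_PiE) auto
qed

lemma maximal_packing_broadcast_exists:
  assumes fin: "finite (pverts G)"
  shows "\<exists>f. maximal_packing_broadcast G f"
proof -
  let ?P = "{f. packing_broadcast G f}"
  have "?P \<subseteq> pverts G \<rightarrow>\<^sub>E {0..diam G}"
    by (auto simp: packing_broadcast_def broadcast_def)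
  moreover have "finite (pverts G \<rightarrow>\<^sub>E {0..diam G})"
    using fin by (intro finite_PiE) auto
  ultimately have finP: "finite ?P" by (rule finite_subset)
  have "packing_broadcast G (\<lambda>v\<in>pverts G. 0)"
    by (auto simp: packing_broadcast_def broadcast_def hearing_set_def broadcast_support_def
        cong: conj_cong)
  then have neP: "?P \<noteq> {}" by blast
  have "Max (broadcast_cost G ` ?P) \<in> broadcast_cost G ` ?P"
    using finP neP by (intro Max_in) auto
  then obtain f where f: "packing_broadcast G f"
    and f_Max: "broadcast_cost G f = Max (broadcast_cost G ` ?P)" by auto
  have mx: "broadcast_cost G g \<le> broadcast_cost G f" if "packing_broadcast G g" for g
    unfolding f_Max using finP that by (intro Max_ge) auto
  have "g = f" if g: "packing_broadcast G g" and le: "\<forall>v\<in>pverts G. f v \<le> g v" for g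
  proof (rule ccontr)
    assume "g \<noteq> f"
    moreover have "g \<in> extensional (pverts G)" "f \<in> extensional (pverts G)"
      using f g by (auto simp: packing_broadcast_def broadcast_def PiE_def)
    ultimately obtain v where "v \<in> pverts G" "f v \<noteq> g v"
      by (metis extensionalityI)
    with le have "\<exists>v\<in>pverts G. f v < g v"
      by (metis le_neq_implies_less)
    with le fin have "broadcast_cost G f < broadcast_cost G g"
      unfolding broadcast_cost_def by (intro sum_strict_mono_ex1) auto
    with mx[OF g] show False by simp
  qed
  with f show ?thesis
    unfolding maximal_packing_broadcast_def by blast
qed

end

theory Submission
  imports Defs "Graph_Theory.Digraph_Component"
begin

text \<open>
  Let \<open>f\<close> be a maximal packing broadcast of cost \<open>C\<close> on \<open>P\<^sub>n\<close> with \<open>m\<close> broadcasting vertices. If a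
  positive \<open>f v\<close> is the eccentricity of \<open>v\<close>, then \<open>n \<le> 2 * C + 1\<close>. Otherwise every ball of radius
  \<open>f v\<close> abuts another one, and the balls of radius \<open>f v + 1\<close> cover the path. At least half of the
  balls abut one on their left; there the two enlarged balls overlap in two vertices, which can be
  removed from the right one. Since \<open>m \<le> C\<close>, the lengths of the trimmed balls add up to at most
  \<open>2 * C + 3 * m - 2 * (m - m div 2) \<le> 3 * C + 2 * (C div 2)\<close>.

  This bound is attained by balls of radius one: if every ball abuts another, then two more balls,
  centred at \<open>n + 3\<close> and \<open>n + 6\<close>, extend a maximal packing broadcast from \<open>P\<^sub>n\<close> to \<open>P\<^bsub>n + 8\<^esub>\<close>.
\<close>

subsection \<open>Distances\<close>

lemma (in pair_wf_digraph) gdist_le_length: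
  assumes "awalk u p v"
  shows "gdist G u v \<le> length p"
  unfolding gdist_def using assms by (intro Least_le) blast

lemma (in pair_wf_digraph) geodesic_exists:
  assumes "u \<rightarrow>\<^sup>*\<^bsub>with_proj G\<^esub> v"
  obtains p where "awalk u p v" "length p = gdist G u v"
proof -
  from assms have "\<exists>k p. awalk u p v \<and> length p = k"
    by (auto simp: reachable_awalk)
  then have "\<exists>p. awalk u p v \<and> length p = gdist G u v"
    unfolding gdist_def by (rule LeastI_ex)
  with that show thesis by blast
qed

lemma length_rev_path [simp]: "length (rev_path p) = length p"
  by (induction p) auto

lemma (in pair_sym_digraph) gdist_commute: "gdist G u v = gdist G v u"
proof -
  have "(\<exists>p. awalk u p v \<and> length p = k) \<longleftrightarrow> (\<exists>p. awalk v p u \<and> length p = k)" for k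
    by (metis awalk_rev_path length_rev_path)
  then show ?thesis by (simp add: gdist_def)
qed

locale connected_pair_graph = pair_graph +
  assumes strongly_connected: "strongly_connected (with_proj G)"
begin

lemma reachable_verts:
  assumes "u \<in> pverts G" "v \<in> pverts G"
  shows "u \<rightarrow>\<^sup>*\<^bsub>with_proj G\<^esub> v"
  using assms strongly_connected by (auto simp: strongly_connected_def)

lemma gdist_self [simp]:
  assumes "v \<in> pverts G"
  shows "gdist G v v = 0"
  using gdist_le_length[of v "[]" v] assms by (simp add: awalk_Nil_iff)

lemma gdist_triangle:
  assumes "u \<in> pverts G" "v \<in> pverts G" "w \<in> pverts G"
  shows "gdist G u w \<le> gdist G u v + gdist G v w"
proof -
  obtain p where uv: "awalk u p v" "length p = gdist G u v"
    using assms by (blast intro: geodesic_exists reachable_verts)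
  obtain q where vw: "awalk v q w" "length q = gdist G v w"
    using assms by (blast intro: geodesic_exists reachable_verts)
  from uv vw have "awalk u (p @ q) w" by (blast intro: awalk_appendI)
  with uv vw show ?thesis by (metis gdist_le_length length_append)
qed

lemma gdist_split:
  assumes "u \<in> pverts G" "w \<in> pverts G" "gdist G u w \<le> a + b"
  obtains v where "v \<in> pverts G" "gdist G u v \<le> a" "gdist G v w \<le> b"
proof -
  obtain p where geodesic: "awalk u p w" "length p = gdist G u w"
    using assms by (blast intro: geodesic_exists reachable_verts)
  define v where "v = awlast u (take a p)"
  have "awalk u (take a p @ drop a p) w" using geodesic by simp
  then have walks: "awalk u (take a p) v" "awalk v (drop a p) w"
    unfolding awalk_append_iff v_def by simp_all
  show thesis
  proof
    show "v \<in> pverts G" using walks by (auto dest: awalk_last_in_verts)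
    show "gdist G u v \<le> a" using gdist_le_length[OF walks(1)] by simp
    show "gdist G v w \<le> b" using gdist_le_length[OF walks(2)] geodesic assms by simp
  qed
qed

end

lemma gdist_le_eccentricity:
  assumes "finite (pverts G)" "u \<in> pverts G"
  shows "gdist G v u \<le> eccentricity G v"
  unfolding eccentricity_def using assms by (intro Max_ge) auto

lemma eccentricity_le_diam:
  assumes "finite (pverts G)" "v \<in> pverts G"
  shows "eccentricity G v \<le> diam G"
  unfolding eccentricity_def diam_def
proof (rule Max_mono)
  show "gdist G v ` pverts G \<subseteq> {gdist G u w |u w. u \<in> pverts G \<and> w \<in> pverts G}"
    using assms by auto
  show "gdist G v ` pverts G \<noteq> {}" using assms by auto
  show "finite {gdist G u w |u w. u \<in> pverts G \<and> w \<in> pverts G}"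
    using assms by (intro finite_image_set2) auto
qed

subsection \<open>Packing broadcasts\<close>

lemma broadcast_iff:
  assumes "finite (pverts G)"
  shows "broadcast G f \<longleftrightarrow>
    f \<in> extensional (pverts G) \<and> (\<forall>v\<in>pverts G. f v \<le> eccentricity G v)"
  using eccentricity_le_diam[OF assms]
  by (fastforce simp: broadcast_def PiE_def Pi_def)

lemma broadcast_cost_eq_sum_support:
  assumes "finite (pverts G)"
  shows "broadcast_cost G f = sum f (broadcast_support G f)"
  unfolding broadcast_cost_def broadcast_support_def
  using assms by (intro sum.mono_neutral_right) auto

lemma packing_broadcast_antimono:
  assumes "finite (pverts G)" "packing_broadcast G g"
    and "f \<in> extensional (pverts G)" "\<And>v. v \<in> pverts G \<Longrightarrow> f v \<le> g v"
  shows "packing_broadcast G f"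
proof -
  have "broadcast G f"
    using assms by (fastforce simp: packing_broadcast_def broadcast_iff)
  moreover have "card (hearing_set G f u) \<le> 1" if "u \<in> pverts G" for u
  proof -
    have "hearing_set G f u \<subseteq> hearing_set G g u"
      using assms(4) by (fastforce simp: hearing_set_def broadcast_support_def)
    moreover have "finite (hearing_set G g u)"
      using assms(1) by (simp add: hearing_set_def broadcast_support_def)
    ultimately have "card (hearing_set G f u) \<le> card (hearing_set G g u)"
      by (intro card_mono)
    also have "\<dots> \<le> 1"
      using assms(2) that by (simp add: packing_broadcast_def)
    finally show ?thesis .
  qed
  ultimately show ?thesis by (simp add: packing_broadcast_def)
qed

lemma maximal_packing_broadcast_iff_fun_upd:
  assumes "finite (pverts G)"
  shows "maximal_packing_broadcast G f \<longleftrightarrow>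
    packing_broadcast G f \<and> (\<forall>v\<in>pverts G. \<not> packing_broadcast G (f(v := Suc (f v))))"
    (is "_ \<longleftrightarrow> _ \<and> ?saturated")
proof (intro iffI conjI)
  assume maximal: "maximal_packing_broadcast G f"
  then show "packing_broadcast G f" by (simp add: maximal_packing_broadcast_def)
  have "f(v := Suc (f v)) \<noteq> f" for v by (metis fun_upd_same n_not_Suc_n)
  with maximal show ?saturated
    unfolding maximal_packing_broadcast_def by (metis fun_upd_apply le_SucI order_refl)
next
  assume saturated: "packing_broadcast G f \<and> ?saturated"
  have "g = f" if packing: "packing_broadcast G g" and above: "\<forall>v\<in>pverts G. f v \<le> g v" for g
  proof (rule ccontr)
    assume "g \<noteq> f"
    moreover have ext: "g \<in> extensional (pverts G)" "f \<in> extensional (pverts G)"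
      using saturated packing assms by (auto simp: packing_broadcast_def broadcast_iff)
    ultimately obtain v where differ: "v \<in> pverts G" "f v \<noteq> g v"
      by (metis extensionalityI)
    have "packing_broadcast G (f(v := Suc (f v)))"
    proof (rule packing_broadcast_antimono[OF assms packing])
      show "f(v := Suc (f v)) \<in> extensional (pverts G)"
        using ext differ by (auto simp: extensional_def)
      show "(f(v := Suc (f v))) u \<le> g u" if "u \<in> pverts G" for u
        using above differ that by (simp add: Suc_le_eq le_neq_implies_less)
    qed
    with saturated differ show False by blast
  qed
  with saturated show "maximal_packing_broadcast G f"
    by (auto simp: maximal_packing_broadcast_def)
qed

lemma lower_broadcast_packing_number_le:
  assumes "finite (pverts G)" "maximal_packing_broadcast G f"
  shows "p\<^sub>b G \<le> broadcast_cost G f"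
  unfolding lower_broadcast_packing_number_def
  using assms finite_maximal_packing_broadcasts by (intro Min_le) auto

lemma lower_broadcast_packing_number_attained:
  assumes "finite (pverts G)"
  obtains f where "maximal_packing_broadcast G f" "broadcast_cost G f = p\<^sub>b G"
proof -
  have "p\<^sub>b G \<in> broadcast_cost G ` {f. maximal_packing_broadcast G f}"
    unfolding lower_broadcast_packing_number_def
    using assms maximal_packing_broadcast_exists finite_maximal_packing_broadcasts
    by (intro Min_in) auto
  with that show thesis by auto
qed

text \<open>
  The last condition says that no value of the indicator function of \<open>S\<close> can be raised from 1 to 2.
\<close>

definition maximal_unit_packing :: "'a pair_pre_digraph \<Rightarrow> 'a set \<Rightarrow> bool" where
  "maximal_unit_packing G S \<longleftrightarrow>
     S \<subseteq> pverts G \<and>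
     (\<forall>v\<in>S. \<forall>w\<in>S. v \<noteq> w \<longrightarrow> 3 \<le> gdist G v w) \<and>
     (\<forall>u\<in>pverts G. \<exists>w\<in>S. gdist G u w \<le> 2) \<and>
     (\<forall>v\<in>S. eccentricity G v = 1 \<or> (\<exists>w\<in>S. gdist G v w = 3))"

context connected_pair_graph
begin

lemma packing_broadcast_iff_gdist:
  "packing_broadcast G f \<longleftrightarrow> broadcast G f \<and>
     (\<forall>v\<in>broadcast_support G f. \<forall>w\<in>broadcast_support G f. v \<noteq> w \<longrightarrow> f v + f w < gdist G v w)"
    (is "_ \<longleftrightarrow> _ \<and> ?separated")
proof -
  let ?H = "hearing_set G f"
  have finite_H: "finite (?H u)" for u
    using pair_finite_verts by (simp add: hearing_set_def broadcast_support_def)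
  have "(\<forall>u\<in>pverts G. card (?H u) \<le> 1) \<longleftrightarrow> ?separated"
  proof (intro iffI ballI impI)
    fix v w
    assume card_le: "\<forall>u\<in>pverts G. card (?H u) \<le> 1"
      and v_supp: "v \<in> broadcast_support G f" and w_supp: "w \<in> broadcast_support G f" and "v \<noteq> w"
    show "f v + f w < gdist G v w"
    proof (rule ccontr)
      assume "\<not> f v + f w < gdist G v w"
      with v_supp w_supp obtain u
        where common: "u \<in> pverts G" "gdist G v u \<le> f v" "gdist G u w \<le> f w"
        by (auto simp: broadcast_support_def not_less elim: gdist_split)
      then have "v \<in> ?H u" "w \<in> ?H u"
        using v_supp w_supp by (simp_all add: hearing_set_def gdist_commute)
      with \<open>v \<noteq> w\<close> card_le common finite_H show False
        by (metis One_nat_def card_le_Suc0_iff_eq)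
    qed
  next
    fix u
    assume separated: ?separated and u_vert: "u \<in> pverts G"
    have "v = w" if hears: "v \<in> ?H u" "w \<in> ?H u" for v w
    proof -
      have "gdist G v w \<le> gdist G u v + gdist G u w"
        using u_vert hears gdist_triangle[of v u w]
        by (simp add: hearing_set_def broadcast_support_def gdist_commute)
      also have "\<dots> \<le> f v + f w"
        using hears by (auto simp: hearing_set_def)
      finally show ?thesis
        using separated hears by (auto simp: hearing_set_def not_less[symmetric])
    qed
    then show "card (?H u) \<le> 1"
      using finite_H by (metis One_nat_def card_le_Suc0_iff_eq)
  qed
  then show ?thesis by (simp add: packing_broadcast_def)
qed

lemma packing_broadcast_fun_upd_Suc_iff:
  assumes packing: "packing_broadcast G f" and v_vert: "v \<in> pverts G"
  shows "packing_broadcast G (f(v := Suc (f v))) \<longleftrightarrow> f v < eccentricity G v \<and>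
    (\<forall>w\<in>broadcast_support G f. w \<noteq> v \<longrightarrow> f v + f w + 1 < gdist G v w)"
proof -
  let ?g = "f(v := Suc (f v))"
  have "broadcast_support G ?g = insert v (broadcast_support G f)"
    using v_vert by (auto simp: broadcast_support_def)
  moreover have "broadcast G ?g \<longleftrightarrow> f v < eccentricity G v"
    using packing v_vert pair_finite_verts
    by (auto simp: packing_broadcast_def broadcast_iff extensional_def)
  ultimately show ?thesis
    using packing by (auto simp: packing_broadcast_iff_gdist gdist_commute add.commute)
qed

lemma maximal_packing_broadcast_iff_gdist:
  "maximal_packing_broadcast G f \<longleftrightarrow> packing_broadcast G f \<and>
     (\<forall>v\<in>pverts G. f v = eccentricity G v \<or>
       (\<exists>w\<in>broadcast_support G f. w \<noteq> v \<and> gdist G v w \<le> f v + f w + 1))"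
proof (cases "packing_broadcast G f")
  case True
  then have "f v \<le> eccentricity G v" if "v \<in> pverts G" for v
    using that by (simp add: packing_broadcast_def broadcast_def)
  with True show ?thesis
    by (fastforce simp: maximal_packing_broadcast_iff_fun_upd pair_finite_verts
        packing_broadcast_fun_upd_Suc_iff not_less)
qed (simp add: maximal_packing_broadcast_def)

lemma maximal_packing_broadcast_nearly_dominating:
  assumes "maximal_packing_broadcast G f" "x \<in> pverts G" "0 < eccentricity G x"
  obtains v where "v \<in> broadcast_support G f" "gdist G x v \<le> f v + 1"
proof (cases "f x = 0")
  case True
  with assms that show thesis
    by (auto simp: maximal_packing_broadcast_iff_gdist)
next
  case False
  with assms that[of x] show thesis
    by (simp add: broadcast_support_def)
qed

lemma maximal_packing_broadcast_abutting:
  assumes maximal: "maximal_packing_broadcast G f"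
    and supp: "v \<in> broadcast_support G f" and not_full: "f v \<noteq> eccentricity G v"
  obtains w where "w \<in> broadcast_support G f" "gdist G v w = f v + f w + 1"
proof -
  have "v \<in> pverts G" using supp by (simp add: broadcast_support_def)
  with maximal not_full obtain w
    where touching: "w \<in> broadcast_support G f" "w \<noteq> v" "gdist G v w \<le> f v + f w + 1"
    by (auto simp: maximal_packing_broadcast_iff_gdist)
  have "f v + f w < gdist G v w"
    using maximal supp touching
    by (auto simp: maximal_packing_broadcast_def packing_broadcast_iff_gdist)
  with touching show thesis by (intro that) auto
qed

lemma maximal_packing_broadcast_of_unit_packing:
  assumes "maximal_unit_packing G S"
  shows "maximal_packing_broadcast G (\<lambda>v\<in>pverts G. of_bool (v \<in> S))"
proof -
  let ?f = "\<lambda>v\<in>pverts G. of_bool (v \<in> S) :: nat"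
  have subset: "S \<subseteq> pverts G"
    and far: "\<And>v w. v \<in> S \<Longrightarrow> w \<in> S \<Longrightarrow> v \<noteq> w \<Longrightarrow> 3 \<le> gdist G v w"
    and near: "\<And>u. u \<in> pverts G \<Longrightarrow> \<exists>w\<in>S. gdist G u w \<le> 2"
    and tight: "\<And>v. v \<in> S \<Longrightarrow> eccentricity G v = 1 \<or> (\<exists>w\<in>S. gdist G v w = 3)"
    using assms by (auto simp: maximal_unit_packing_def)
  have supp: "broadcast_support G ?f = S"
    using subset by (auto simp: broadcast_support_def)
  have "1 \<le> eccentricity G v" if "v \<in> S" for v
    using tight[OF that]
  proof
    assume "\<exists>w\<in>S. gdist G v w = 3"
    then obtain w where "w \<in> pverts G" "gdist G v w = 3" using subset by blast
    with gdist_le_eccentricity[OF pair_finite_verts, of w v] show ?thesis by simp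
  qed simp
  then have "broadcast G ?f"
    by (simp add: broadcast_iff pair_finite_verts)
  then have "packing_broadcast G ?f"
    using subset far unfolding packing_broadcast_iff_gdist supp by fastforce
  moreover have "?f v = eccentricity G v \<or> (\<exists>w\<in>S. w \<noteq> v \<and> gdist G v w \<le> ?f v + ?f w + 1)"
    if v_vert: "v \<in> pverts G" for v
  proof (cases "v \<in> S")
    case True
    with v_vert subset tight[OF True] show ?thesis by force
  next
    case False
    with v_vert subset near[OF v_vert] show ?thesis by force
  qed
  ultimately show ?thesis
    by (simp add: maximal_packing_broadcast_iff_gdist supp)
qed

lemma lower_broadcast_packing_number_le_card:
  assumes "maximal_unit_packing G S"
  shows "p\<^sub>b G \<le> card S"
proof -
  let ?f = "\<lambda>v\<in>pverts G. of_bool (v \<in> S) :: nat"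
  have "p\<^sub>b G \<le> broadcast_cost G ?f"
    using assms by (intro lower_broadcast_packing_number_le pair_finite_verts
        maximal_packing_broadcast_of_unit_packing)
  also have "broadcast_cost G ?f = card S"
    using assms pair_finite_verts
    by (simp add: broadcast_cost_def maximal_unit_packing_def Int_absorb1)
  finally show ?thesis .
qed

end

subsection \<open>Path graphs\<close>

lemma pverts_path_graph [simp]: "pverts (path_graph n) = {1..n}"
  by (simp add: path_graph_def)

lemma mem_parcs_path_graph:
  "(u, v) \<in> parcs (path_graph n) \<longleftrightarrow> u \<in> {1..n} \<and> v \<in> {1..n} \<and> (v = u + 1 \<or> u = v + 1)"
  by (simp add: path_graph_def)

lemma path_graph_length_awalk_ge:
  assumes "pre_digraph.awalk (with_proj (path_graph n)) u p v"
  shows "nat \<bar>int u - int v\<bar> \<le> length p"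
proof -
  interpret pair_graph "path_graph n" by (rule pair_graph_path_graph)
  from assms show ?thesis
    by (induction p arbitrary: u) (force simp: awalk_Nil_iff awalk_Cons_iff mem_parcs_path_graph)+
qed

lemma path_graph_awalk_exists:
  assumes "1 \<le> u" "u + k \<le> n"
  obtains p where "pre_digraph.awalk (with_proj (path_graph n)) u p (u + k)" "length p = k"
proof -
  interpret pair_graph "path_graph n" by (rule pair_graph_path_graph)
  from assms have "\<exists>p. awalk u p (u + k) \<and> length p = k"
  proof (induction k arbitrary: u)
    case 0
    then show ?case by (simp add: awalk_Nil_iff)
  next
    case (Suc k)
    from Suc.IH[of "u + 1"] Suc.prems obtain p where "awalk (u + 1) p (u + 1 + k)" "length p = k"
      by auto
    with Suc.prems show ?case
      by (intro exI[of _ "(u, u + 1) # p"]) (simp add: awalk_Cons_iff mem_parcs_path_graph)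
  qed
  with that show thesis by blast
qed

lemma gdist_path_graph:
  assumes "u \<in> {1..n}" "v \<in> {1..n}"
  shows "gdist (path_graph n) u v = nat \<bar>int u - int v\<bar>"
proof -
  interpret pair_graph "path_graph n" by (rule pair_graph_path_graph)
  have ascending: "gdist (path_graph n) u v = v - u" if "u \<in> {1..n}" "v \<in> {1..n}" "u \<le> v" for u v
    unfolding gdist_def
  proof (rule Least_equality)
    show "\<exists>p. awalk u p v \<and> length p = v - u"
      using that path_graph_awalk_exists[of u "v - u" n] by auto
    show "v - u \<le> k" if "\<exists>p. awalk u p v \<and> length p = k" for k
      using that by (fastforce dest: path_graph_length_awalk_ge)
  qed
  show ?thesis
  proof (cases "u \<le> v")
    case True
    with assms show ?thesis by (simp add: ascending)
  next
    case False
    with assms show ?thesis by (simp add: ascending gdist_commute[of u v])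
  qed
qed

lemma connected_pair_graph_path_graph:
  assumes "1 \<le> n"
  shows "connected_pair_graph (path_graph n)"
proof -
  interpret pair_graph "path_graph n" by (rule pair_graph_path_graph)
  have "u \<rightarrow>\<^sup>*\<^bsub>with_proj (path_graph n)\<^esub> v" if "u \<in> {1..n}" "v \<in> {1..n}" for u v
  proof -
    have "\<exists>p. awalk u p v" if "u \<in> {1..n}" "v \<in> {1..n}" "u \<le> v" for u v
      using that path_graph_awalk_exists[of u "v - u" n] by auto
    with that show ?thesis
      unfolding reachable_awalk by (meson awalk_rev_path nle_le)
  qed
  with assms have "strongly_connected (with_proj (path_graph n))"
    by (intro strongly_connectedI) auto
  then show ?thesis
    by unfold_locales
qed

lemma eccentricity_path_graph:
  assumes "v \<in> {1..n}"
  shows "eccentricity (path_graph n) v = max (v - 1) (n - v)"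
  unfolding eccentricity_def
proof (rule Max_eqI)
  show "y \<le> max (v - 1) (n - v)" if "y \<in> gdist (path_graph n) v ` pverts (path_graph n)" for y
    using that assms by (auto simp: gdist_path_graph)
  have "v - 1 = gdist (path_graph n) v 1" "n - v = gdist (path_graph n) v n"
    using assms by (auto simp: gdist_path_graph)
  moreover have "1 \<in> pverts (path_graph n)" "n \<in> pverts (path_graph n)"
    using assms by auto
  ultimately show "max (v - 1) (n - v) \<in> gdist (path_graph n) v ` pverts (path_graph n)"
    by (metis imageI max_def)
qed simp

subsection \<open>Lower bound\<close>

definition max_path_order :: "nat \<Rightarrow> nat" where
  "max_path_order C = 3 * C + 2 * (C div 2)"

lemma mono_max_path_order: "mono max_path_order"
  unfolding max_path_order_def by (intro monoI add_mono mult_le_mono div_le_mono) simp_all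

locale abutting_balls =
  fixes S :: "nat set" and f :: "nat \<Rightarrow> nat" and n :: nat
  assumes finite_S: "finite S"
    and radius_pos: "v \<in> S \<Longrightarrow> 0 < f v"
    and separated: "u \<in> S \<Longrightarrow> v \<in> S \<Longrightarrow> u < v \<Longrightarrow> u + f u + f v < v"
    and nearly_covered: "x \<in> {1..n} \<Longrightarrow> \<exists>v\<in>S. x \<le> v + f v + 1 \<and> v \<le> x + f v + 1"
    and abutting: "v \<in> S \<Longrightarrow> \<exists>w\<in>S. w = v + f v + f w + 1 \<or> v = w + f w + f v + 1"
begin

definition left_abutting :: "nat set" where
  "left_abutting = {v \<in> S. \<exists>u\<in>S. v = u + f u + f v + 1}"

lemma finite_left_abutting: "finite left_abutting"
  using finite_S by (simp add: left_abutting_def)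

lemma inj_on_right_end: "inj_on (\<lambda>v. v + f v) S"
proof (rule linorder_inj_onI')
  show "u + f u \<noteq> v + f v" if "u \<in> S" "v \<in> S" "u < v" for u v
    using separated[OF that] by simp
qed

lemma card_le_twice_left_abutting: "card S \<le> 2 * card left_abutting"
proof -
  have "(\<lambda>v. v + f v) ` (S - left_abutting) \<subseteq> (\<lambda>v. v - f v - 1) ` left_abutting"
  proof
    fix e
    assume "e \<in> (\<lambda>v. v + f v) ` (S - left_abutting)"
    then obtain u where not_left: "u \<in> S" "u \<notin> left_abutting" "e = u + f u" by auto
    then obtain v where "v \<in> S" "v = u + f u + f v + 1"
      using abutting[of u] by (auto simp: left_abutting_def)
    with not_left have "v \<in> left_abutting" "e = v - f v - 1"
      by (auto simp: left_abutting_def)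
    then show "e \<in> (\<lambda>v. v - f v - 1) ` left_abutting" by blast
  qed
  then have "card ((\<lambda>v. v + f v) ` (S - left_abutting)) \<le> card left_abutting"
    by (rule surj_card_le[OF finite_left_abutting])
  then have "card (S - left_abutting) \<le> card left_abutting"
    using inj_on_subset[OF inj_on_right_end] by (simp add: card_image)
  moreover have "card (S - left_abutting) = card S - card left_abutting"
    by (intro card_Diff_subset finite_left_abutting) (auto simp: left_abutting_def)
  ultimately show ?thesis by simp
qed

text \<open>Truncated subtraction cuts a ball off at \<open>0\<close>, which is not a vertex of the path.\<close>

definition trimmed_ball :: "nat \<Rightarrow> nat set" where
  "trimmed_ball v =
     (if v \<in> left_abutting then {v - f v + 1..v + f v + 1} else {v - f v - 1..v + f v + 1})"

lemma card_trimmed_ball: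
  "card (trimmed_ball v) + 2 * of_bool (v \<in> left_abutting) \<le> 2 * f v + 3"
  by (auto simp: trimmed_ball_def left_abutting_def)

lemma trimmed_balls_cover: "{1..n} \<subseteq> (\<Union>v\<in>S. trimmed_ball v)"
proof
  fix x
  assume "x \<in> {1..n}"
  then obtain v where near: "v \<in> S" "x \<le> v + f v + 1" "v \<le> x + f v + 1"
    using nearly_covered by blast
  show "x \<in> (\<Union>v\<in>S. trimmed_ball v)"
  proof (cases "x \<in> trimmed_ball v")
    case False
    with near obtain u where left_neighbour: "u \<in> S" "v = u + f u + f v + 1" "x \<le> v - f v"
      by (auto simp: trimmed_ball_def left_abutting_def split: if_splits)
    with near left_neighbour radius_pos[of u] have "x \<in> trimmed_ball u"
      by (auto simp: trimmed_ball_def)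
    with left_neighbour show ?thesis by blast
  qed (use near in blast)
qed

lemma le_max_path_order: "n \<le> max_path_order (sum f S)"
proof -
  have "n = card {1..n}" by simp
  also have "\<dots> \<le> card (\<Union>v\<in>S. trimmed_ball v)"
    using finite_S by (intro card_mono trimmed_balls_cover) (simp add: trimmed_ball_def)
  also have "\<dots> \<le> (\<Sum>v\<in>S. card (trimmed_ball v))"
    using finite_S by (rule card_UN_le)
  finally have "n + 2 * card left_abutting \<le>
      (\<Sum>v\<in>S. card (trimmed_ball v) + 2 * of_bool (v \<in> left_abutting))"
    using finite_S by (simp add: sum.distrib sum_distrib_left[symmetric] left_abutting_def Int_def)
  also have "\<dots> \<le> (\<Sum>v\<in>S. 2 * f v + 3)"
    by (intro sum_mono card_trimmed_ball)
  also have "\<dots> = 2 * sum f S + 3 * card S"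
    by (simp add: sum.distrib sum_distrib_left)
  finally have "n + 2 * card left_abutting \<le> 2 * sum f S + 3 * card S" .
  moreover have "card S \<le> sum f S"
    using sum_mono[of S "\<lambda>_. 1" f] radius_pos by (simp add: Suc_le_eq)
  moreover from this have "card S div 2 \<le> sum f S div 2" by (rule div_le_mono)
  moreover have "card S \<le> card left_abutting + card S div 2"
    using card_le_twice_left_abutting by linarith
  ultimately show ?thesis unfolding max_path_order_def by linarith
qed

end

lemma abutting_balls_broadcast_support:
  assumes maximal: "maximal_packing_broadcast (path_graph n) f" and order: "2 \<le> n"
    and not_full: "\<And>v. v \<in> broadcast_support (path_graph n) f \<Longrightarrow>
      f v \<noteq> eccentricity (path_graph n) v"
  shows "abutting_balls (broadcast_support (path_graph n) f) f n"
proof -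
  interpret connected_pair_graph "path_graph n"
    using order by (intro connected_pair_graph_path_graph) simp
  let ?S = "broadcast_support (path_graph n) f"
  have supp: "v \<in> {1..n}" "0 < f v" if "v \<in> ?S" for v
    using that by (simp_all add: broadcast_support_def)
  show ?thesis
  proof
    show "finite ?S" by (simp add: broadcast_support_def)
    show "0 < f v" if "v \<in> ?S" for v using that by (rule supp)
    show "u + f u + f v < v" if "u \<in> ?S" "v \<in> ?S" "u < v" for u v
    proof -
      have "f u + f v < gdist (path_graph n) u v"
        using maximal that by (auto simp: maximal_packing_broadcast_def packing_broadcast_iff_gdist)
      with that supp show ?thesis by (simp add: gdist_path_graph)
    qed
    show "\<exists>v\<in>?S. x \<le> v + f v + 1 \<and> v \<le> x + f v + 1" if x_vert: "x \<in> {1..n}" for x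
    proof -
      have "0 < eccentricity (path_graph n) x"
        using x_vert order by (auto simp: eccentricity_path_graph)
      with maximal x_vert obtain v where "v \<in> ?S" "gdist (path_graph n) x v \<le> f v + 1"
        by (auto elim: maximal_packing_broadcast_nearly_dominating)
      with x_vert supp[of v] show ?thesis by (intro bexI[of _ v]) (auto simp: gdist_path_graph)
    qed
    show "\<exists>w\<in>?S. w = v + f v + f w + 1 \<or> v = w + f w + f v + 1" if v_supp: "v \<in> ?S" for v
    proof -
      obtain w where "w \<in> ?S" "gdist (path_graph n) v w = f v + f w + 1"
        using maximal_packing_broadcast_abutting[OF maximal v_supp not_full[OF v_supp]] by blast
      with supp[OF v_supp] supp[of w] show ?thesis
        by (intro bexI[of _ w]) (auto simp: gdist_path_graph)
    qed
  qed
qed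

lemma le_max_path_order_broadcast_cost:
  assumes maximal: "maximal_packing_broadcast (path_graph n) f" and order: "2 \<le> n"
  shows "n \<le> max_path_order (broadcast_cost (path_graph n) f)"
proof (cases "\<exists>v\<in>broadcast_support (path_graph n) f. f v = eccentricity (path_graph n) v")
  case True
  then obtain v where full: "v \<in> {1..n}" "0 < f v" "f v = eccentricity (path_graph n) v"
    by (auto simp: broadcast_support_def)
  then have "f v \<le> broadcast_cost (path_graph n) f"
    unfolding broadcast_cost_def by (intro member_le_sum) auto
  moreover have "n \<le> 2 * f v + 1"
    using full by (auto simp: eccentricity_path_graph)
  ultimately show ?thesis
    using \<open>0 < f v\<close> unfolding max_path_order_def by linarith
next
  case False
  then interpret abutting_balls "broadcast_support (path_graph n) f" f n
    using maximal order by (intro abutting_balls_broadcast_support) auto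
  show ?thesis
    using le_max_path_order by (simp add: broadcast_cost_eq_sum_support)
qed

subsection \<open>Upper bound\<close>

lemma maximal_unit_packing_path_graph_iff:
  "maximal_unit_packing (path_graph n) S \<longleftrightarrow>
     S \<subseteq> {1..n} \<and>
     (\<forall>v\<in>S. \<forall>w\<in>S. v \<noteq> w \<longrightarrow> v + 3 \<le> w \<or> w + 3 \<le> v) \<and>
     (\<forall>u\<in>{1..n}. \<exists>w\<in>S. u \<le> w + 2 \<and> w \<le> u + 2) \<and>
     (\<forall>v\<in>S. max (v - 1) (n - v) = 1 \<or> (\<exists>w\<in>S. w = v + 3 \<or> v = w + 3))"
proof (cases "S \<subseteq> {1..n}")
  case True
  then have "v \<in> S \<Longrightarrow> v \<in> {1..n}" for v by blast
  moreover have "3 \<le> gdist (path_graph n) u w \<longleftrightarrow> u + 3 \<le> w \<or> w + 3 \<le> u"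
    "gdist (path_graph n) u w \<le> 2 \<longleftrightarrow> u \<le> w + 2 \<and> w \<le> u + 2"
    "gdist (path_graph n) u w = 3 \<longleftrightarrow> w = u + 3 \<or> u = w + 3"
    if "u \<in> {1..n}" "w \<in> {1..n}" for u w
    using that by (auto simp: gdist_path_graph)
  ultimately show ?thesis
    unfolding maximal_unit_packing_def
    by (simp add: eccentricity_path_graph del: atLeastAtMost_iff cong: conj_cong ball_cong bex_cong)
qed (simp add: maximal_unit_packing_def)

lemma maximal_unit_packing_path_graph_extend:
  assumes packing: "maximal_unit_packing (path_graph n) S" and order: "4 \<le> n"
  shows "maximal_unit_packing (path_graph (n + 8)) (S \<union> {n + 3, n + 6})"
  unfolding maximal_unit_packing_path_graph_iff
proof (intro conjI ballI impI)
  have subset: "S \<subseteq> {1..n}"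
    and far: "\<And>v w. v \<in> S \<Longrightarrow> w \<in> S \<Longrightarrow> v \<noteq> w \<Longrightarrow> v + 3 \<le> w \<or> w + 3 \<le> v"
    and near: "\<And>u. u \<in> {1..n} \<Longrightarrow> \<exists>w\<in>S. u \<le> w + 2 \<and> w \<le> u + 2"
    and tight: "\<And>v. v \<in> S \<Longrightarrow> max (v - 1) (n - v) = 1 \<or> (\<exists>w\<in>S. w = v + 3 \<or> v = w + 3)"
    using packing unfolding maximal_unit_packing_path_graph_iff by blast+
  show "S \<union> {n + 3, n + 6} \<subseteq> {1..n + 8}" using subset by auto
  show "v + 3 \<le> w \<or> w + 3 \<le> v"
    if "v \<in> S \<union> {n + 3, n + 6}" "w \<in> S \<union> {n + 3, n + 6}" "v \<noteq> w" for v w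
    using that subset far[of v w] by fastforce
  show "\<exists>w\<in>S \<union> {n + 3, n + 6}. u \<le> w + 2 \<and> w \<le> u + 2" if "u \<in> {1..n + 8}" for u
  proof (cases "u \<le> n")
    case True
    with that near[of u] show ?thesis by auto
  next
    case False
    with that show ?thesis by auto
  qed
  show "max (v - 1) (n + 8 - v) = 1 \<or> (\<exists>w\<in>S \<union> {n + 3, n + 6}. w = v + 3 \<or> v = w + 3)"
    if "v \<in> S \<union> {n + 3, n + 6}" for v
  proof (cases "v \<in> S")
    case True
    with order tight[OF True] show ?thesis by auto
  qed (use that in auto)
qed

lemma maximal_unit_packing_path_graph_exists:
  assumes "4 \<le> n" "n \<le> max_path_order C"
  shows "\<exists>S. maximal_unit_packing (path_graph n) S \<and> card S \<le> C"
  using assms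
proof (induction n arbitrary: C rule: less_induct)
  case (less n)
  have "2 \<le> C" using less.prems unfolding max_path_order_def by presburger
  consider (up_to_6) "n \<le> 6" | (from_6_to_8) "6 \<le> n" "n \<le> 8"
    | (from_9_to_11) "9 \<le> n" "n \<le> 11" | (from_12) "12 \<le> n"
    by linarith
  then show ?case
  proof cases
    case up_to_6
    with less.prems have "maximal_unit_packing (path_graph n) {1, 4}"
      by (auto simp: maximal_unit_packing_path_graph_iff)
    moreover have "card {1, 4 :: nat} \<le> C" using \<open>2 \<le> C\<close> by simp
    ultimately show ?thesis by blast
  next
    case from_6_to_8
    then have "maximal_unit_packing (path_graph n) {3, 6}"
      by (auto simp: maximal_unit_packing_path_graph_iff)
    moreover have "card {3, 6 :: nat} \<le> C" using \<open>2 \<le> C\<close> by simp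
    ultimately show ?thesis by blast
  next
    case from_9_to_11
    then have "maximal_unit_packing (path_graph n) {3, 6, 9}"
      by (auto simp: maximal_unit_packing_path_graph_iff)
    moreover have "card {3, 6, 9 :: nat} \<le> C"
      using from_9_to_11 less.prems by (simp add: max_path_order_def)
    ultimately show ?thesis by blast
  next
    case from_12
    obtain D where C_eq: "C = D + 2" using \<open>2 \<le> C\<close> by (metis le_add_diff_inverse2)
    have "n - 8 \<le> max_path_order D"
      using less.prems by (simp add: C_eq max_path_order_def)
    moreover have "n - 8 < n" "4 \<le> n - 8" using from_12 by simp_all
    ultimately obtain S
      where packing: "maximal_unit_packing (path_graph (n - 8)) S" and card_S: "card S \<le> D"
      using less.IH by blast
    have "maximal_unit_packing (path_graph n) (S \<union> {n - 5, n - 2})"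
      using maximal_unit_packing_path_graph_extend[OF packing] from_12 by simp
    moreover have "card (S \<union> {n - 5, n - 2}) \<le> C"
      using card_Un_le[of S "{n - 5, n - 2}"] card_S from_12 by (simp add: C_eq)
    ultimately show ?thesis by blast
  qed
qed

lemma lower_broadcast_packing_number_path_graph_le_iff:
  assumes order: "2 \<le> n"
  shows "p\<^sub>b (path_graph n) \<le> C \<longleftrightarrow> n \<le> max_path_order C"
proof
  assume cost: "p\<^sub>b (path_graph n) \<le> C"
  obtain f where "maximal_packing_broadcast (path_graph n) f"
      "broadcast_cost (path_graph n) f = p\<^sub>b (path_graph n)"
    using lower_broadcast_packing_number_attained[of "path_graph n"] by auto
  with order have "n \<le> max_path_order (p\<^sub>b (path_graph n))"
    using le_max_path_order_broadcast_cost by metis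
  also have "\<dots> \<le> max_path_order C"
    using mono_max_path_order cost by (rule monoD)
  finally show "n \<le> max_path_order C" .
next
  assume bound: "n \<le> max_path_order C"
  interpret connected_pair_graph "path_graph n"
    using order by (intro connected_pair_graph_path_graph) simp
  obtain S where "maximal_unit_packing (path_graph n) S" "card S \<le> C"
  proof (cases "4 \<le> n")
    case True
    with that bound show ?thesis
      using maximal_unit_packing_path_graph_exists by blast
  next
    case False
    with order have "maximal_unit_packing (path_graph n) {2}"
      by (auto simp: maximal_unit_packing_path_graph_iff)
    moreover have "card {2 :: nat} \<le> C"
      using order bound by (cases C) (auto simp: max_path_order_def)
    ultimately show ?thesis by (rule that)
  qed
  then show "p\<^sub>b (path_graph n) \<le> C"
    using lower_broadcast_packing_number_le_card by (meson le_trans)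
qed

lemma le_max_path_order_iff:
  "n \<le> max_path_order C \<longleftrightarrow>
     (if n mod 8 = 0 then n div 4
      else if n mod 8 \<in> {1, 2, 3} then 2 * (n div 8) + 1
      else 2 * (n div 8) + 2) \<le> C"
    (is "_ \<longleftrightarrow> ?R \<le> C")
proof -
  define q r where "q = n div 8" and "r = n mod 8"
  then have n_eq: "n = 8 * q + r" "r < 8" by simp_all
  then have R_eq: "?R = (if r = 0 then 2 * q else if r \<le> 3 then 2 * q + 1 else 2 * q + 2)"
    by auto
  obtain k where "C = 2 * k \<or> C = 2 * k + 1" by (metis evenE oddE)
  with n_eq show ?thesis
    unfolding max_path_order_def R_eq by (cases q k rule: linorder_cases) auto
qed

theorem theorem3p16:
  fixes n :: nat
  assumes "n \<ge> 2"
  shows "p\<^sub>b (path_graph n) =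
    (if n mod 8 = 0 then n div 4
     else if n mod 8 \<in> {1, 2, 3} then 2 * (n div 8) + 1
     else 2 * (n div 8) + 2)"
    (is "_ = ?R")
proof -
  have le_iff: "p\<^sub>b (path_graph n) \<le> C \<longleftrightarrow> ?R \<le> C" for C
    using assms
    by (simp only: lower_broadcast_packing_number_path_graph_le_iff le_max_path_order_iff)
  show ?thesis
  proof (rule antisym)
    show "p\<^sub>b (path_graph n) \<le> ?R" by (simp only: le_iff order_refl)
    show "?R \<le> p\<^sub>b (path_graph n)" by (simp only: le_iff[symmetric] order_refl)
  qed
qed

end
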